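(* Let $\mathbf{h}=0112122122212222122222\cdots$ be the fixed point starting with $0$ of the morphism $0\mapsto01$, $1\mapsto12$, $2\mapsto2$. Then the abelian complexity $b^{(1)}_{\mathbf{h}}$ is unbounded and $b^{(1)}_{\mathbf{h}}\prec b^{(2)}_{\mathbf{h}}\prec b^{(3)}_{\mathbf{h}}=p_{\mathbf{h}}$.
   Context: For words $u,w$, $\binom{u}{w}$ is the number of occurrences of $w$ as a scattered subword of $u$; $u\sim_j v$ if $\binom{u}{x}=\binom{v}{x}$ for all words $x$ of length at most $j$. $b^{(j)}_{\mathbf{x}}(n)$ is the number of $\sim_j$-classes among length-$n$ factors of $\mathbf{x}$ ($j=1$ gives the abelian complexity), and $p_{\mathbf{x}}(n)$ is the number of length-$n$ factors. For $f,g\colon\mathbb{N}\to\mathbb{N}$, $f\prec g$ means $f(n)<g(n)$ for infinitely many $n$. *)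

theory Defs
  imports Main "HOL-Library.Stream" "HOL-Library.Infinite_Set"
begin

text \<open>Finite words are lists and right-infinite words are streams.\<close>

definition binom_word :: "'a list \<Rightarrow> 'a list \<Rightarrow> nat" where
  "binom_word u w = card {I. I \<subseteq> {..<length u} \<and> nths u I = w}"

definition binom_equiv :: "nat \<Rightarrow> 'a list \<Rightarrow> 'a list \<Rightarrow> bool" where
  "binom_equiv j u v \<longleftrightarrow> (\<forall>x. length x \<le> j \<longrightarrow> binom_word u x = binom_word v x)"

definition factors :: "'a stream \<Rightarrow> nat \<Rightarrow> 'a list set" where
  "factors x n = {stake n (sdrop i x) | i. True}"

definition factor_complexity :: "'a stream \<Rightarrow> nat \<Rightarrow> nat" where
  "factor_complexity x n = card (factors x n)"

definition binom_complexity :: "nat \<Rightarrow> 'a stream \<Rightarrow> nat \<Rightarrow> nat" where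
  "binom_complexity j x n = card (factors x n // {(u, v). binom_equiv j u v})"

definition inf_often_less :: "(nat \<Rightarrow> nat) \<Rightarrow> (nat \<Rightarrow> nat) \<Rightarrow> bool"  (infix "\<prec>" 50) where
  "f \<prec> g \<longleftrightarrow> (\<exists>\<^sub>\<infinity>n. f n < g n)"

text \<open>
  The image of an infinite word under the morphism extending \<open>f\<close>. Since \<^const>\<open>flat\<close> is only
  meaningful on streams of nonempty lists, \<open>f\<close> has to be non-erasing.
\<close>
definition morph_stream :: "('a \<Rightarrow> 'b list) \<Rightarrow> 'a stream \<Rightarrow> 'b stream" where
  "morph_stream f x = flat (smap f x)"

datatype letter = L0 | L1 | L2

fun phi :: "letter \<Rightarrow> letter list" where
  "phi L0 = [L0, L1]"
| "phi L1 = [L1, L2]"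
| "phi L2 = [L2]"

lemma phi_nonempty [simp]: "phi a \<noteq> []"
  by (cases a) auto

lemma flat_smap_shift:
  assumes "\<And>a. f a \<noteq> []"
  shows "flat (smap f (xs @- s)) = concat (map f xs) @- flat (smap f s)"
  using assms by (induction xs) (simp_all add: flat_unfold[of "f _ ## _"])

lemma length_concat_map_ge:
  assumes "\<And>a. f a \<noteq> []"
  shows "length xs \<le> length (concat (map f xs))"
proof (induction xs)
  case (Cons a xs)
  have "1 \<le> length (f a)"
    using assms[of a] by (cases "f a") auto
  with Cons show ?case by simp
qed simp

lemma stream_eqI_snth: "(\<And>n. s !! n = t !! n) \<Longrightarrow> s = t"
  using smap_alt[of "\<lambda>x. x" s t] by (simp add: stream.map_ident)

lemma flat_smap_flat_snth:
  assumes f: "\<And>a. f a \<noteq> []" and ws: "\<forall>xs\<in>sset ws. xs \<noteq> []"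
  shows "flat (smap f (flat ws)) !! n = flat (smap (\<lambda>w. concat (map f w)) ws) !! n"
  using ws
proof (induction n arbitrary: ws rule: less_induct)
  case (less n)
  obtain w ws' where ws_eq: "ws = w ## ws'" by (cases ws)
  with less.prems have w: "w \<noteq> []" and ws': "\<forall>xs\<in>sset ws'. xs \<noteq> []" by auto
  let ?c = "concat (map f w)"
  have len: "0 < length ?c"
    using length_concat_map_ge[of f w] f w by (cases w) auto
  have l: "flat (smap f (flat ws)) = ?c @- flat (smap f (flat ws'))"
    unfolding ws_eq using w f by (simp add: flat_smap_shift del: smap_shift)
  have r: "flat (smap (\<lambda>w. concat (map f w)) ws) = ?c @- flat (smap (\<lambda>w. concat (map f w)) ws')"
    unfolding ws_eq using len by (simp add: flat_unfold[of "_ ## _"])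
  show ?case
  proof (cases "n < length ?c")
    case True
    then show ?thesis unfolding l r by (simp add: shift_snth_less)
  next
    case False
    then have "n - length ?c < n" using len by linarith
    from less.IH[OF this ws'] False show ?thesis
      unfolding l r by (simp add: shift_snth_ge)
  qed
qed

lemma ex1_fixed_point_phi: "\<exists>!h. morph_stream phi h = h \<and> shd h = L0"
proof (rule ex_ex1I)
  let ?F = "\<lambda>w. concat (map phi w)"
  have ne: "(?F ^^ n) [L1] \<noteq> []" for n
  proof (induction n)
    case (Suc n)
    then show ?case by (cases "(?F ^^ n) [L1]") auto
  qed simp
  have ne': "\<forall>w\<in>sset (siterate ?F [L1]). w \<noteq> []"
  proof
    fix w assume "w \<in> sset (siterate ?F [L1])"
    then obtain n where "w = (?F ^^ n) [L1]" unfolding sset_siterate by blast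
    with ne[of n] show "w \<noteq> []" by (simp only: not_False_eq_True)
  qed
  define t where "t = flat (siterate ?F [L1])"
  have "flat (smap phi t) = flat (smap ?F (siterate ?F [L1]))"
    unfolding t_def
    by (rule stream_eqI_snth, rule flat_smap_flat_snth) (simp_all add: ne')
  also have "\<dots> = flat (siterate ?F (?F [L1]))"
    by (simp only: smap_siterate)
  finally have "t = L1 ## flat (smap phi t)"
    unfolding t_def by (subst siterate.code) (simp add: t_def)
  then have "morph_stream phi (L0 ## t) = L0 ## t \<and> shd (L0 ## t) = L0"
    by (simp add: morph_stream_def)
  then show "\<exists>h. morph_stream phi h = h \<and> shd h = L0" ..
next
  fix x y
  assume x: "morph_stream phi x = x \<and> shd x = L0" and y: "morph_stream phi y = y \<and> shd y = L0"
  have key: "z !! n = concat (map phi (stake n z)) ! n"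
    if z: "morph_stream phi z = z \<and> shd z = L0" and n: "0 < n" for z n
  proof -
    obtain m where m: "n = Suc m" using n by (cases n) auto
    have "length (concat (map phi (stake n z))) = 2 + length (concat (map phi (stake m (stl z))))"
      using z by (simp add: m)
    then have less: "n < length (concat (map phi (stake n z)))"
      using length_concat_map_ge[of phi "stake m (stl z)"] by (simp add: m)
    have "z = flat (smap phi (stake n z @- sdrop n z))"
      using z by (simp add: morph_stream_def stake_sdrop)
    then have "z = concat (map phi (stake n z)) @- flat (smap phi (sdrop n z))"
      by (simp only: flat_smap_shift[OF phi_nonempty])
    then show ?thesis using less by (metis shift_snth_less)
  qed
  have "stake n x = stake n y" for n
  proof (induction n)
    case (Suc n)
    have "x !! n = y !! n"
    proof (cases "n = 0")
      case True
      then show ?thesis using x y by simp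
    next
      case False
      then show ?thesis using key[OF x] key[OF y] Suc by simp
    qed
    with Suc show ?case by (simp only: stake_Suc)
  qed simp
  then have "x !! n = y !! n" for n
    by (metis lessI stake_nth)
  then show "x = y" by (rule stream_eqI_snth)
qed

end

theory Submission
  imports Defs
begin

text \<open>
  The word is \<open>h = 0 \<cdot> 1 \<cdot> 12 \<cdot> 122 \<cdot> 1222 \<cdots>\<close>, so consecutive gaps between the ones increase by one.
  Describe a factor over \<open>{1,2}\<close> by the numbers \<open>y\<^sub>0 \<ge> y\<^sub>1 \<ge> \<dots>\<close> of twos following each of its
  \<open>m\<close> ones, where \<open>y\<^sub>j - y\<^sub>j\<^sub>+\<^sub>1 = k + j\<close> for some \<open>k\<close>. The coefficients of \<open>1\<close>, \<open>12\<close> and \<open>122\<close> are \<open>m\<close>,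
  \<open>\<Sum>y\<^sub>j\<close> and \<open>\<Sum>y\<^sub>j(y\<^sub>j - 1)/2\<close>. Given \<open>m\<close> and the mean of the \<open>y\<^sub>j\<close>, their variance is strictly
  increasing in \<open>k\<close>, so \<open>\<sim>\<^sub>3\<close> is equality on factors. On the other hand \<open>m\<close> and the mean alone do
  not separate \<open>2 1 2\<^sup>k 1 2\<^sup>k\<^sup>+\<^sup>1 1 2\<close> from \<open>1 2\<^sup>k\<^sup>+\<^sup>1 1 2\<^sup>k\<^sup>+\<^sup>2 1\<close>, and \<open>m\<close> alone does not separate
  \<open>12\<^sup>n\<^sup>-\<^sup>1\<close> from \<open>212\<^sup>n\<^sup>-\<^sup>2\<close>. Finally the number of ones in a window of length \<open>n\<close> changes by at most one when
  the window is shifted, so it takes all values between \<open>1\<close> and its value at the beginning of the word.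
\<close>

section \<open>Binomial coefficients of words\<close>

lemma binom_word_Nil_left: "binom_word [] w = (if w = [] then 1 else 0)"
proof -
  have "{I. I \<subseteq> {..<length ([]::'a list)} \<and> nths [] I = w} = (if w = [] then {{}} else {})"
    by auto
  then show ?thesis unfolding binom_word_def by simp
qed

lemma finite_nths_eq: "finite {I. I \<subseteq> {..<length u} \<and> nths u I = w}"
  by (rule finite_subset[of _ "Pow {..<length u}"]) auto

lemma nths_index_sets_Cons:
  "{I. I \<subseteq> {..<length (a # u)} \<and> nths (a # u) I = w} =
    (\<lambda>I. Suc ` I) ` {I. I \<subseteq> {..<length u} \<and> nths u I = w}
    \<union> (\<lambda>I. insert 0 (Suc ` I)) ` {I. I \<subseteq> {..<length u} \<and> a # nths u I = w}"
  (is "?L = ?A \<union> ?B")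
proof (intro equalityI subsetI)
  fix I assume I: "I \<in> ?L"
  define J where "J = {j. Suc j \<in> I}"
  have J: "J \<subseteq> {..<length u}" using I by (auto simp: J_def)
  have w: "w = (if 0 \<in> I then [a] else []) @ nths u J"
    using I by (simp add: nths_Cons J_def)
  show "I \<in> ?A \<union> ?B"
  proof (cases "0 \<in> I")
    case True
    have "I = insert 0 (Suc ` J)"
    proof (intro set_eqI)
      show "x \<in> I \<longleftrightarrow> x \<in> insert 0 (Suc ` J)" for x
        using True by (cases x) (auto simp: J_def)
    qed
    then show ?thesis using True J w by auto
  next
    case False
    have "I = Suc ` J"
    proof (intro set_eqI)
      show "x \<in> I \<longleftrightarrow> x \<in> Suc ` J" for x
        using False by (cases x) (auto simp: J_def)
    qed
    then show ?thesis using False J w by auto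
  qed
next
  fix I assume "I \<in> ?A \<union> ?B"
  then show "I \<in> ?L"
    by (auto simp: nths_Cons image_iff)
qed

text \<open>Pascal's rule: an occurrence either avoids the leading letter or matches it with the
  first letter of \<open>w\<close>. Later coefficients are computed by induction with this rule,
  without index sets.\<close>

lemma binom_word_Cons:
  "binom_word (a # u) w =
    binom_word u w + (case w of [] \<Rightarrow> 0 | b # w' \<Rightarrow> if a = b then binom_word u w' else 0)"
proof -
  let ?S = "{I. I \<subseteq> {..<length u} \<and> nths u I = w}"
  let ?T = "{I. I \<subseteq> {..<length u} \<and> a # nths u I = w}"
  have T: "?T = (case w of [] \<Rightarrow> {} | b # w' \<Rightarrow> if a = b then {I. I \<subseteq> {..<length u} \<and> nths u I = w'} else {})"
    by (auto split: list.splits)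
  have finT: "finite ?T"
    by (rule finite_subset[of _ "Pow {..<length u}"]) auto
  have inj1: "inj_on (\<lambda>I. Suc ` I) ?S"
    by (rule inj_onI) (simp add: inj_image_eq_iff)
  have inj2: "inj_on (\<lambda>I. insert 0 (Suc ` I)) ?T"
  proof (rule inj_onI)
    fix I J :: "nat set" assume "insert 0 (Suc ` I) = insert 0 (Suc ` J)"
    then have "Suc ` I = Suc ` J" by (metis image_iff insert_ident nat.distinct(1))
    then show "I = J" by (simp add: inj_image_eq_iff)
  qed
  have "binom_word (a # u) w = card ((\<lambda>I. Suc ` I) ` ?S \<union> (\<lambda>I. insert 0 (Suc ` I)) ` ?T)"
    unfolding binom_word_def nths_index_sets_Cons ..
  also have "\<dots> = card ((\<lambda>I. Suc ` I) ` ?S) + card ((\<lambda>I. insert 0 (Suc ` I)) ` ?T)"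
    using finT finite_nths_eq by (intro card_Un_disjoint) auto
  also have "\<dots> = card ?S + card ?T"
    using inj1 inj2 by (simp add: card_image)
  finally show ?thesis
    unfolding T by (simp add: binom_word_def split: list.splits)
qed

lemma binom_word_Nil_right [simp]: "binom_word u [] = 1"
  by (induction u) (simp_all add: binom_word_Nil_left binom_word_Cons)

lemma binom_word_single: "binom_word u [a] = count_list u a"
  by (induction u) (simp_all add: binom_word_Nil_left binom_word_Cons)

lemma binom_word_same_pair: "binom_word u [a, a] = count_list u a choose 2"
  by (induction u)
    (simp_all add: binom_word_Nil_left binom_word_Cons binom_word_single numeral_2_eq_2)

text \<open>Each pair of an \<open>a\<close> and a \<open>b\<close> in \<open>u\<close> stands in
  exactly one of the two orders.\<close>

lemma binom_word_pair_swap: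
  assumes "a \<noteq> b"
  shows "binom_word u [a, b] + binom_word u [b, a] = count_list u a * count_list u b"
  using assms
  by (induction u) (auto simp: binom_word_Nil_left binom_word_Cons binom_word_single)

lemma binom_equiv_mono: "binom_equiv j u v \<Longrightarrow> i \<le> j \<Longrightarrow> binom_equiv i u v"
  by (simp add: binom_equiv_def)

lemma binom_equivD: "binom_equiv j u v \<Longrightarrow> length x \<le> j \<Longrightarrow> binom_word u x = binom_word v x"
  by (simp add: binom_equiv_def)

lemma binom_equiv_1_iff: "binom_equiv 1 u v \<longleftrightarrow> (\<forall>a. count_list u a = count_list v a)"
proof
  show "\<forall>a. count_list u a = count_list v a" if "binom_equiv 1 u v"
    using binom_equivD[OF that, of "[_]"] by (simp add: binom_word_single)
  show "binom_equiv 1 u v" if "\<forall>a. count_list u a = count_list v a"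
    unfolding binom_equiv_def
  proof (intro allI impI)
    fix x :: "'a list" assume "length x \<le> 1"
    then have "x = [] \<or> (\<exists>a. x = [a])" by (cases x) auto
    then show "binom_word u x = binom_word v x"
      using that by (auto simp: binom_word_single)
  qed
qed

text \<open>The coefficient of \<open>[a, a]\<close> depends only on the count of \<open>a\<close>,
  that of \<open>[L2, L1]\<close> follows by swapping, and pairs involving \<open>L0\<close>
  contribute nothing. Beyond the counts, only \<open>[L1, L2]\<close> is left to compare.\<close>

lemma binom_equiv_2I:
  assumes c: "\<And>a. count_list u a = count_list v a" and L0: "L0 \<notin> set u"
    and p: "binom_word u [L1, L2] = binom_word v [L1, L2]"
  shows "binom_equiv 2 u v"
  unfolding binom_equiv_def
proof (intro allI impI)
  fix x :: "letter list" assume "length x \<le> 2"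
  then consider "length x \<le> 1" | "length x = 2" by linarith
  then show "binom_word u x = binom_word v x"
  proof cases
    case 1
    then show ?thesis using c binom_equivD[of 1 u v x] binom_equiv_1_iff[of u v] by simp
  next
    case 2
    then obtain a b where x: "x = [a, b]"
      by (auto simp: length_Suc_conv numeral_2_eq_2)
    have z: "count_list u L0 = 0" "count_list v L0 = 0"
      using L0 c[of L0] by (simp_all add: count_list_0_iff)
    have "binom_word u [L2, L1] = binom_word v [L2, L1]"
      using binom_word_pair_swap[of L1 L2 u] binom_word_pair_swap[of L1 L2 v] p c by simp
    moreover have "binom_word w [a, L0] = 0 \<and> binom_word w [L0, a] = 0"
      if "a \<noteq> L0" "count_list w L0 = 0" for a w
      using binom_word_pair_swap[of a L0 w] that by simp
    ultimately show ?thesis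
      unfolding x using c p z
      by (cases "a = b"; cases a; cases b) (simp_all add: binom_word_same_pair)
  qed
qed

section \<open>Counting classes\<close>

lemma quotient_binom_equiv:
  "A // {(u, v). binom_equiv j u v} = (\<lambda>u. {v. binom_equiv j u v}) ` A"
  by (auto simp: quotient_def Image_def)

lemma binom_class_eq_iff:
  "{w. binom_equiv j u w} = {w. binom_equiv j v w} \<longleftrightarrow> binom_equiv j u v"
  by (auto simp: binom_equiv_def set_eq_iff)

lemma image_factors_through:
  assumes "\<And>x y. x \<in> A \<Longrightarrow> y \<in> A \<Longrightarrow> f x = f y \<Longrightarrow> g x = g y"
  shows "\<exists>r. \<forall>x\<in>A. r (f x) = g x"
proof (intro exI[of _ "\<lambda>z. g (inv_into A f z)"] ballI)
  show "g (inv_into A f (f x)) = g x" if "x \<in> A" for x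
    by (rule assms) (use that in \<open>auto intro: inv_into_into f_inv_into_f\<close>)
qed

lemma card_image_le_card_image:
  assumes fin: "finite A" and fg: "\<And>x y. x \<in> A \<Longrightarrow> y \<in> A \<Longrightarrow> f x = f y \<Longrightarrow> g x = g y"
  shows "card (g ` A) \<le> card (f ` A)"
proof -
  obtain r where "\<forall>x\<in>A. r (f x) = g x"
    using image_factors_through[of A f g, OF fg] ..
  then have "g ` A = r ` f ` A" by (simp add: image_image)
  then show ?thesis using fin by (simp add: card_image_le)
qed

text \<open>Here \<open>f\<close> is a labelling at least as fine as \<open>g\<close>. The induced
  map from \<open>f\<close>-labels onto \<open>g\<close>-labels merges those of \<open>a\<close> and
  \<open>b\<close>, so it shrinks a finite set.\<close>

lemma card_image_less_card_image:
  assumes fin: "finite A" and fg: "\<And>x y. x \<in> A \<Longrightarrow> y \<in> A \<Longrightarrow> f x = f y \<Longrightarrow> g x = g y"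
    and ab: "a \<in> A" "b \<in> A" "g a = g b" "f a \<noteq> f b"
  shows "card (g ` A) < card (f ` A)"
proof -
  obtain r where r: "\<forall>x\<in>A. r (f x) = g x"
    using image_factors_through[of A f g, OF fg] ..
  then have img: "g ` A = r ` f ` A" by (simp add: image_image)
  have "\<not> inj_on r (f ` A)"
    using ab r by (metis image_eqI inj_onD)
  then have "card (r ` f ` A) \<noteq> card (f ` A)"
    using fin eq_card_imp_inj_on by blast
  moreover have "card (r ` f ` A) \<le> card (f ` A)"
    using fin by (simp add: card_image_le)
  ultimately show ?thesis using img by simp
qed

lemma finite_factors: "finite (factors (x :: 'a::finite stream) n)"
  by (rule finite_subset[OF _ finite_lists_length_eq[of UNIV n]]) (auto simp: factors_def)

lemma finite_UNIV_letter: "finite (UNIV :: letter set)"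
proof -
  have "(UNIV :: letter set) = {L0, L1, L2}" by (auto intro: letter.exhaust)
  then show ?thesis by (metis finite.emptyI finite_insert)
qed

instance letter :: finite
  by standard (rule finite_UNIV_letter)

lemma binom_complexity_less:
  fixes x :: "'a::finite stream"
  assumes "i \<le> j" "u \<in> factors x n" "v \<in> factors x n" "binom_equiv i u v" "\<not> binom_equiv j u v"
  shows "binom_complexity i x n < binom_complexity j x n"
  unfolding binom_complexity_def quotient_binom_equiv
  by (rule card_image_less_card_image[of _ _ _ u v])
    (use assms in \<open>auto simp: finite_factors binom_class_eq_iff intro: binom_equiv_mono\<close>)

lemma binom_complexity_eq_factor_complexity:
  assumes "\<And>u v. u \<in> factors x n \<Longrightarrow> v \<in> factors x n \<Longrightarrow> binom_equiv j u v \<Longrightarrow> u = v"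
  shows "binom_complexity j x n = factor_complexity x n"
  unfolding binom_complexity_def factor_complexity_def quotient_binom_equiv
  by (rule card_image, rule inj_onI) (use assms in \<open>simp add: binom_class_eq_iff\<close>)

lemma card_count_le_binom_complexity_1:
  fixes x :: "'a::finite stream"
  shows "card ((\<lambda>u. count_list u a) ` factors x n) \<le> binom_complexity 1 x n"
  unfolding binom_complexity_def quotient_binom_equiv
  by (rule card_image_le_card_image)
    (simp_all add: finite_factors binom_class_eq_iff binom_equiv_1_iff del: One_nat_def)

section \<open>The structure of the fixed point\<close>

text \<open>The parameter puts the tails of the word from all of its ones into one family, on which
  \<open>phi\<close> acts by raising \<open>k\<close> by one.\<close>

definition blocks :: "nat \<Rightarrow> letter stream" where
  "blocks k = flat (smap (\<lambda>i. L1 # replicate i L2) (fromN k))"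

lemma blocks_unfold: "blocks k = L1 ## replicate k L2 @- blocks (Suc k)"
  unfolding blocks_def by (subst siterate.code) simp

lemma flat_smap_phi_blocks: "flat (smap phi (blocks k)) = blocks (Suc k)"
proof -
  have "flat (smap phi (blocks k)) =
      flat (smap (\<lambda>w. concat (map phi w)) (smap (\<lambda>i. L1 # replicate i L2) (fromN k)))"
    unfolding blocks_def
    by (rule stream_eqI_snth, rule flat_smap_flat_snth) (auto simp: stream.set_map)
  also have "\<dots> = flat (smap ((\<lambda>i. L1 # replicate i L2) \<circ> Suc) (fromN k))"
  proof -
    \<comment> \<open>\<open>phi\<close> sends \<open>1\<close> to \<open>12\<close> and fixes
      \<open>2\<close>, so each block gains exactly one \<open>2\<close>.\<close>
    have "concat (map phi (L1 # replicate i L2)) = L1 # replicate (Suc i) L2" for i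
      by (induction i) simp_all
    then have "(\<lambda>w. concat (map phi w)) \<circ> (\<lambda>i. L1 # replicate i L2) = (\<lambda>i. L1 # replicate i L2) \<circ> Suc"
      by (simp add: fun_eq_iff)
    then show ?thesis by (simp only: stream.map_comp)
  qed
  also have "\<dots> = blocks (Suc k)"
    unfolding blocks_def by (simp only: stream.map_comp[symmetric] smap_siterate)
  finally show ?thesis .
qed

lemma fixed_point_eq_blocks:
  assumes "morph_stream phi h = h" and "shd h = L0"
  shows "h = L0 ## blocks 0"
proof -
  have "morph_stream phi (L0 ## blocks 0) = L0 ## L1 ## blocks (Suc 0)"
    by (simp add: morph_stream_def flat_smap_phi_blocks)
  \<comment> \<open>The block of index \<open>0\<close> is the single letter \<open>L1\<close>,
    which the image of \<open>L0\<close> supplies.\<close>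
  also have "\<dots> = L0 ## blocks 0"
    by (subst blocks_unfold[of 0]) simp
  finally show ?thesis
    using assms ex1_fixed_point_phi by (metis stream.sel(1))
qed

lemma sdrop_blocks: "\<exists>a k'. sdrop i (blocks k) = replicate a L2 @- blocks k'"
proof (induction i)
  case 0
  have "sdrop 0 (blocks k) = replicate 0 L2 @- blocks k" by simp
  then show ?case by blast
next
  case (Suc i)
  then obtain a k' where s: "sdrop i (blocks k) = replicate a L2 @- blocks k'" by blast
  have t: "sdrop (Suc i) (blocks k) = stl (sdrop i (blocks k))"
    by (simp only: sdrop.simps sdrop_stl)
  show ?case
  proof (cases a)
    case 0
    then have "sdrop (Suc i) (blocks k) = replicate k' L2 @- blocks (Suc k')"
      unfolding t s by (subst blocks_unfold) simp
    then show ?thesis by blast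
  next
    case (Suc b)
    then have "sdrop (Suc i) (blocks k) = replicate b L2 @- blocks k'"
      unfolding t s by simp
    then show ?thesis by blast
  qed
qed

text \<open>Each of the \<open>k\<close> earlier blocks contributes one \<open>1\<close>. The count
  later yields windows with many ones.\<close>

lemma blocks_0_split:
  "\<exists>w. blocks 0 = w @- blocks k \<and> count_list w L1 = k"
proof (induction k)
  case 0
  have "blocks 0 = [] @- blocks 0 \<and> count_list [] L1 = 0" by simp
  then show ?case by blast
next
  case (Suc k)
  then obtain w where "blocks 0 = w @- blocks k" "count_list w L1 = k" by blast
  then have "blocks 0 = (w @ L1 # replicate k L2) @- blocks (Suc k)
      \<and> count_list (w @ L1 # replicate k L2) L1 = Suc k"
    by (subst (asm) blocks_unfold[of k]) (simp add: count_list_0_iff)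
  then show ?case by blast
qed

lemma sdrop_length_shift: "sdrop (length w) (w @- s) = s"
  by (induction w) simp_all

lemma stake_length_shift: "stake (length w) (w @- s) = w"
  by (induction w) simp_all

lemma replicate_shift_SCons: "replicate n a @- a ## s = a ## replicate n a @- s"
  by (induction n) simp_all

lemma stake_sdrop_in_factors: "stake n (sdrop i x) \<in> factors x n"
  by (auto simp: factors_def)

lemma factor_of_suffixI:
  assumes "x = w @- u @- s" and "n = length u"
  shows "u \<in> factors x n"
  using stake_sdrop_in_factors[of n "length w" x] assms
  by (simp add: sdrop_length_shift stake_length_shift)

text \<open>For \<open>k > 0\<close> the block before \<open>blocks k\<close> ends in
  \<open>k - 1\<close> twos, so a run of \<open>a < k\<close> twos can be taken from it.\<close>

lemma factor_blocksI:
  assumes "replicate a L2 @- blocks k = u @- s" and "a < k \<or> a = 0"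
  shows "u \<in> factors (L0 ## blocks 0) (length u)"
proof (cases "a = 0")
  case True
  obtain w where "blocks 0 = w @- blocks k" using blocks_0_split by blast
  then have "L0 ## blocks 0 = (L0 # w) @- u @- s" using assms True by simp
  then show ?thesis by (rule factor_of_suffixI) simp
next
  case False
  then obtain b where k: "k = Suc (b + a)"
    using assms by (metis add.commute less_imp_Suc_add)
  obtain w where "blocks 0 = w @- blocks (b + a)" using blocks_0_split by blast
  also have "blocks (b + a) = L1 ## replicate b L2 @- replicate a L2 @- blocks k"
    unfolding k by (subst blocks_unfold) (simp add: replicate_add)
  finally have "L0 ## blocks 0 = (L0 # w @ L1 # replicate b L2) @- u @- s"
    using assms by simp
  then show ?thesis by (rule factor_of_suffixI) simp
qed

section \<open>Offsets of the ones\<close>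

fun twos_after :: "letter list \<Rightarrow> nat list" where
  "twos_after [] = []"
| "twos_after (a # u) = (if a = L1 then [count_list u L2] else []) @ twos_after u"

lemma length_twos_after: "length (twos_after u) = count_list u L1"
  by (induction u) auto

text \<open>Here and in the next lemma, occurrences are sorted by the position of their
  \<open>1\<close>.\<close>

lemma sum_twos_after: "binom_word u [L1, L2] = sum_list (twos_after u)"
  by (induction u) (auto simp: binom_word_Nil_left binom_word_Cons binom_word_single)

lemma sum_choose_twos_after:
  "binom_word u [L1, L2, L2] = (\<Sum>y\<leftarrow>twos_after u. y choose 2)"
  by (induction u) (auto simp: binom_word_Nil_left binom_word_Cons binom_word_same_pair)

lemma hd_twos_after_le: "twos_after u \<noteq> [] \<Longrightarrow> hd (twos_after u) \<le> count_list u L2"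
  by (induction u) auto

text \<open>A leading \<open>1\<close> makes the first offset equal to the number of all twos; after
  a leading \<open>2\<close> any first offset is smaller. So the word can be read off from the
  left.\<close>

lemma twos_after_inject:
  assumes "L0 \<notin> set u" "L0 \<notin> set v" "twos_after u = twos_after v"
    "count_list u L2 = count_list v L2"
  shows "u = v"
  using assms
proof (induction u arbitrary: v)
  case Nil
  then show ?case by (cases v; cases "hd v") auto
next
  case (Cons a u)
  show ?case
  proof (cases v)
    case Nil
    then show ?thesis using Cons.prems by (cases a) auto
  next
    case v: (Cons b v')
    have ab: "a = L1 \<or> a = L2" "b = L1 \<or> b = L2"
      using Cons.prems v letter.exhaust by auto
    have "a = b"
    proof (rule ccontr)
      assume "a \<noteq> b"
      then consider "a = L1" "b = L2" | "a = L2" "b = L1" using ab by blast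
      then show False
      proof cases
        case 1
        then show ?thesis
          using Cons.prems v hd_twos_after_le[of v'] by (auto dest: sym)
      next
        case 2
        then show ?thesis
          using Cons.prems v hd_twos_after_le[of u] by auto
      qed
    qed
    then show ?thesis using Cons v ab by auto
  qed
qed

text \<open>The difference of neighbouring offsets is the gap between two consecutive ones, and
  \<open>k\<close> is the first gap. The additive form avoids truncated subtraction.\<close>

definition unit_growth :: "nat \<Rightarrow> nat list \<Rightarrow> bool" where
  "unit_growth k ys \<longleftrightarrow> (\<forall>j. Suc j < length ys \<longrightarrow> ys ! j = ys ! Suc j + k + j)"

text \<open>The second conjunct carries the induction: the offset of a new leading \<open>1\<close>
  is the number of twos in the rest, which exceeds the next offset by the whole gap
  \<open>k\<close>.\<close>

lemma unit_growth_twos_after_stake: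
  "unit_growth k (twos_after (stake n (replicate a L2 @- blocks k))) \<and>
   (twos_after (stake n (replicate a L2 @- blocks k)) \<noteq> [] \<longrightarrow>
     count_list (stake n (replicate a L2 @- blocks k)) L2
       = a + hd (twos_after (stake n (replicate a L2 @- blocks k))))"
proof (induction n arbitrary: a k)
  case 0
  then show ?case by (simp add: unit_growth_def)
next
  case (Suc n)
  show ?case
  proof (cases a)
    case 0
    let ?u = "stake n (replicate k L2 @- blocks (Suc k))"
    have s: "stake (Suc n) (replicate a L2 @- blocks k) = L1 # ?u"
      unfolding 0 by (subst blocks_unfold) simp
    have "unit_growth k (count_list ?u L2 # twos_after ?u)"
      unfolding unit_growth_def
    proof (intro allI impI)
      fix j assume j: "Suc j < length (count_list ?u L2 # twos_after ?u)"
      show "(count_list ?u L2 # twos_after ?u) ! j =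
          (count_list ?u L2 # twos_after ?u) ! Suc j + k + j"
        using Suc.IH[of "Suc k" k] j
        by (cases j) (auto simp: unit_growth_def hd_conv_nth)
    qed
    then show ?thesis unfolding s by (simp add: 0)
  next
    case (Suc b)
    then show ?thesis using Suc.IH[of k b] by simp
  qed
qed

lemma L0_notin_blocks: "L0 \<notin> set (stake n (replicate a L2 @- blocks k))"
proof (induction n arbitrary: a k)
  case (Suc n)
  show ?case
  proof (cases a)
    case 0
    then show ?thesis using Suc[of k "Suc k"] by (subst blocks_unfold) simp
  next
    case (Suc b)
    then show ?thesis using Suc.IH[of b k] by simp
  qed
qed simp

lemma factor_cases:
  assumes "u \<in> factors (L0 ## blocks 0) n"
  obtains "u = stake n (L0 ## blocks 0)" | a k where "u = stake n (replicate a L2 @- blocks k)"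
proof -
  obtain i where u: "u = stake n (sdrop i (L0 ## blocks 0))"
    using assms by (auto simp: factors_def)
  show ?thesis
  proof (cases i)
    case 0
    then show ?thesis using that(1) u by simp
  next
    case (Suc i')
    then show ?thesis using that(2) u sdrop_blocks[of i' 0] by auto
  qed
qed

section \<open>Rigidity of the offsets\<close>

text \<open>The first \<open>j\<close> gaps are summed; doubling avoids a division in
  \<open>j (j - 1) / 2\<close>.\<close>

lemma unit_growth_nth:
  assumes "unit_growth k ys" "j < length ys"
  shows "2 * int (ys ! j) = 2 * int (ys ! 0) - 2 * int k * int j - int j * (int j - 1)"
  using assms(2)
proof (induction j)
  case (Suc j)
  then have "int (ys ! j) = int (ys ! Suc j) + int k + int j"
    using assms(1) by (simp add: unit_growth_def)
  with Suc show ?case by (simp add: algebra_simps)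
qed simp

text \<open>Both sides are \<open>2 m^2\<close> times the covariance of \<open>d\<close> and
  \<open>s\<close>.\<close>

lemma double_sum_differences:
  fixes d s :: "nat \<Rightarrow> int"
  shows "(\<Sum>i<m. \<Sum>j<m. (d i - d j) * (s i - s j)) =
    2 * int m * (\<Sum>i<m. d i * s i) - 2 * (\<Sum>i<m. d i) * (\<Sum>i<m. s i)"
proof -
  have "(\<Sum>i<m. \<Sum>j<m. (d i - d j) * (s i - s j)) =
      (\<Sum>i<m. \<Sum>j<m. d i * s i) + (\<Sum>i<m. \<Sum>j<m. d j * s j)
      - (\<Sum>i<m. \<Sum>j<m. d i * s j) - (\<Sum>i<m. \<Sum>j<m. d j * s i)"
    by (simp add: algebra_simps sum.distrib sum_subtractf)
  moreover have "(\<Sum>i<m. \<Sum>j<m. d j * s i) = (\<Sum>i<m. \<Sum>j<m. d i * s j)"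
    by (rule sum.swap)
  moreover have "(\<Sum>i<m. \<Sum>j<m. d i * s j) = (\<Sum>i<m. d i) * (\<Sum>i<m. s i)"
    by (simp add: sum_product)
  moreover have "(\<Sum>i<m. \<Sum>j<m. d i * s i) = int m * (\<Sum>i<m. d i * s i)"
    by (simp add: sum_distrib_left)
  moreover have "(\<Sum>i<m. \<Sum>j<m. d j * s j) = int m * (\<Sum>i<m. d i * s i)"
    by simp
  ultimately show ?thesis by linarith
qed

text \<open>The covariance of \<open>d = z - y\<close> and \<open>s = z + y\<close> is the
  difference of the variances, hence zero. If \<open>k < l\<close>, both \<open>d\<close> and
  \<open>s\<close> strictly decrease, which makes it positive.\<close>

lemma unit_growth_steepness_le:
  assumes y: "unit_growth k ys" and z: "unit_growth l zs"
    and len: "length ys = m" "length zs = m" "2 \<le> m"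
    and s1: "(\<Sum>i<m. int (ys ! i)) = (\<Sum>i<m. int (zs ! i))"
    and s2: "(\<Sum>i<m. (int (ys ! i))\<^sup>2) = (\<Sum>i<m. (int (zs ! i))\<^sup>2)"
  shows "l \<le> k"
proof (rule ccontr)
  assume "\<not> l \<le> k"
  then have kl: "k < l" by simp
  define d where "d i = int (zs ! i) - int (ys ! i)" for i
  define s where "s i = int (zs ! i) + int (ys ! i)" for i
  have dd: "d i - d j = (int l - int k) * (int j - int i)" if "i < m" "j < m" for i j
  proof -
    have "2 * (d i - d j) = 2 * ((int l - int k) * (int j - int i))"
      using unit_growth_nth[OF y, of i] unit_growth_nth[OF y, of j]
        unit_growth_nth[OF z, of i] unit_growth_nth[OF z, of j] that len
      by (simp add: d_def algebra_simps)
    then show ?thesis by simp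
  qed
  have ss: "s i - s j = (int j - int i) * (int k + int l + int i + int j - 1)"
    if "i < m" "j < m" for i j
  proof -
    have "2 * (s i - s j) = 2 * ((int j - int i) * (int k + int l + int i + int j - 1))"
      using unit_growth_nth[OF y, of i] unit_growth_nth[OF y, of j]
        unit_growth_nth[OF z, of i] unit_growth_nth[OF z, of j] that len
      by (simp add: s_def algebra_simps)
    then show ?thesis by simp
  qed
  have cross: "(d i - d j) * (s i - s j) =
      (int l - int k) * (int k + int l + int i + int j - 1) * (int j - int i)\<^sup>2"
    if "i < m" "j < m" for i j
    using dd[OF that] ss[OF that] by (simp add: power2_eq_square)
  \<comment> \<open>Since \<open>k < l\<close> gives \<open>k + l >= 1\<close>, the middle factor is
    nonnegative even for \<open>i = j = 0\<close>.\<close>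
  have nonneg: "0 \<le> (d i - d j) * (s i - s j)" if "i < m" "j < m" for i j
    unfolding cross[OF that] using kl by (intro mult_nonneg_nonneg) auto
  have "0 < (d 0 - d 1) * (s 0 - s 1)"
    using cross[of 0 1] len kl by simp
  also have "\<dots> \<le> (\<Sum>j<m. (d 0 - d j) * (s 0 - s j))"
    using len by (intro member_le_sum[of 1 _ "\<lambda>j. (d 0 - d j) * (s 0 - s j)"]) (auto intro: nonneg)
  also have "\<dots> \<le> (\<Sum>i<m. \<Sum>j<m. (d i - d j) * (s i - s j))"
    using len by (intro member_le_sum[of 0 _ "\<lambda>i. \<Sum>j<m. (d i - d j) * (s i - s j)"])
      (auto intro!: nonneg sum_nonneg)
  also have "\<dots> = 0"
  proof -
    have "(\<Sum>i<m. d i) = 0" using s1 by (simp add: d_def sum_subtractf)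
    moreover have "(\<Sum>i<m. d i * s i) = 0"
      using s2 by (simp add: d_def s_def sum_subtractf power2_eq_square algebra_simps)
    ultimately show ?thesis by (simp add: double_sum_differences)
  qed
  finally show False by simp
qed

lemma unit_growth_eqI:
  assumes y: "unit_growth k ys" and z: "unit_growth l zs"
    and len: "length ys = length zs"
    and s1: "sum_list ys = sum_list zs"
    and s2: "(\<Sum>y\<leftarrow>ys. y choose 2) = (\<Sum>y\<leftarrow>zs. y choose 2)"
  shows "ys = zs"
proof -
  define m where "m = length ys"
  have m: "length ys = m" "length zs = m" using len by (simp_all add: m_def)
  have S1: "(\<Sum>i<m. int (ws ! i)) = int (sum_list ws)" if "length ws = m" for ws
    using that by (simp add: sum_list_sum_nth atLeast0LessThan)
  have sq: "(int a)\<^sup>2 = 2 * int (a choose 2) + int a" for a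
  proof -
    have "a * a = 2 * (a choose 2) + a"
      by (induction a) (simp_all add: numeral_2_eq_2)
    then show ?thesis unfolding power2_eq_square by (metis of_nat_add of_nat_mult of_nat_numeral)
  qed
  have S2: "(\<Sum>i<m. (int (ws ! i))\<^sup>2) = 2 * int (\<Sum>y\<leftarrow>ws. y choose 2) + int (sum_list ws)"
    if "length ws = m" for ws
    using that by (simp add: sq sum.distrib sum_list_sum_nth atLeast0LessThan sum_distrib_left)
  have e1: "(\<Sum>i<m. int (ys ! i)) = (\<Sum>i<m. int (zs ! i))"
    using S1 m s1 by simp
  have e2: "(\<Sum>i<m. (int (ys ! i))\<^sup>2) = (\<Sum>i<m. (int (zs ! i))\<^sup>2)"
    unfolding S2[OF m(1)] S2[OF m(2)] s1 s2 ..
  \<comment> \<open>Lists with fewer than two entries have no gap to compare; their sum alone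
    decides.\<close>
  consider "m = 0" | "m = 1" | "2 \<le> m" by linarith
  then show ?thesis
  proof cases
    case 1
    then show ?thesis using m by simp
  next
    case 2
    then show ?thesis using m s1 by (auto simp: length_Suc_conv)
  next
    case 3
    have "k = l"
      using unit_growth_steepness_le[OF y z m 3 e1 e2]
        unit_growth_steepness_le[OF z y m(2,1) 3 e1[symmetric] e2[symmetric]] by simp
    \<comment> \<open>With equal steepness the lists differ by a constant, which equal sums force to
      be zero.\<close>
    define c where "c = int (ys ! 0) - int (zs ! 0)"
    have c: "int (ys ! i) = int (zs ! i) + c" if "i < m" for i
      using unit_growth_nth[OF y, of i] unit_growth_nth[OF z, of i] that m \<open>k = l\<close>
      by (simp add: c_def)
    have "(\<Sum>i<m. int (ys ! i)) = (\<Sum>i<m. int (zs ! i)) + int m * c"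
      using c by (simp add: sum.distrib)
    then have "c = 0" using e1 3 by simp
    then show ?thesis using c m by (intro nth_equalityI) auto
  qed
qed

section \<open>The complexities of the fixed point\<close>

text \<open>Among factors of a positive length only the prefix contains \<open>L0\<close>, so the
  count of \<open>L0\<close> isolates it. For the others, the coefficients of \<open>1\<close>,
  \<open>12\<close> and \<open>122\<close> fix the offsets, and the number of twos then fixes the
  word.\<close>

lemma factors_binom_equiv_3_eq:
  assumes u: "u \<in> factors (L0 ## blocks 0) n" and v: "v \<in> factors (L0 ## blocks 0) n"
    and uv: "binom_equiv 3 u v"
  shows "u = v"
proof -
  have cnt: "count_list u a = count_list v a" for a
    using binom_equivD[OF uv, of "[a]"] by (simp add: binom_word_single)
  have len: "length u = n" "length v = n" using u v by (auto simp: factors_def)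
  show ?thesis
  proof (cases "n = 0")
    case True
    then show ?thesis using len by simp
  next
    case False
    then have pre: "count_list (stake n (L0 ## blocks 0)) L0 \<noteq> 0"
      by (cases n) simp_all
    have suf: "count_list (stake n (replicate a L2 @- blocks k)) L0 = 0" for a k
      using L0_notin_blocks by (simp add: count_list_0_iff)
    from u show ?thesis
    proof (cases rule: factor_cases)
      case 1
      from v show ?thesis by (cases rule: factor_cases) (use 1 cnt[of L0] pre suf in auto)
    next
      case u2: (2 a k)
      from v show ?thesis
      proof (cases rule: factor_cases)
        case 1
        then show ?thesis using u2 cnt[of L0] pre suf by auto
      next
        case v2: (2 b l)
        have "twos_after u = twos_after v"
        proof (rule unit_growth_eqI)
          show "unit_growth k (twos_after u)" "unit_growth l (twos_after v)"
            unfolding u2 v2 using unit_growth_twos_after_stake by blast+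
          show "length (twos_after u) = length (twos_after v)"
            by (simp add: length_twos_after cnt)
          show "sum_list (twos_after u) = sum_list (twos_after v)"
            using binom_equivD[OF uv, of "[L1, L2]"] by (simp add: sum_twos_after)
          show "(\<Sum>y\<leftarrow>twos_after u. y choose 2) = (\<Sum>y\<leftarrow>twos_after v. y choose 2)"
            using binom_equivD[OF uv, of "[L1, L2, L2]"] by (simp add: sum_choose_twos_after)
        qed
        then show ?thesis
          using twos_after_inject[of u v] cnt L0_notin_blocks u2 v2 by simp
      qed
    qed
  qed
qed

section \<open>Pairs of factors merged by the coarser equivalence\<close>

lemma count_list_replicate: "count_list (replicate n a) b = (if a = b then n else 0)"
  by (induction n) auto

lemma twos_after_append:
  "twos_after (u @ v) = map (\<lambda>y. y + count_list v L2) (twos_after u) @ twos_after v"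
  by (induction u) auto

lemma twos_after_replicate: "twos_after (replicate n L2) = []"
  by (induction n) auto

lemma binom_complexity_1_less_2:
  "binom_complexity 1 (L0 ## blocks 0) (n + 2) < binom_complexity 2 (L0 ## blocks 0) (n + 2)"
proof -
  let ?u = "L1 # replicate (n + 1) L2" and ?v = "L2 # L1 # replicate n L2"
  have "?u \<in> factors (L0 ## blocks 0) (length ?u)"
  proof (rule factor_blocksI)
    show "replicate 0 L2 @- blocks (n + 1) = ?u @- blocks (n + 2)"
      by (subst blocks_unfold) simp
  qed simp
  moreover have "?v \<in> factors (L0 ## blocks 0) (length ?v)"
  proof (rule factor_blocksI)
    \<comment> \<open>\<open>?v\<close> takes the last \<open>2\<close> of block
      \<open>n + 1\<close> and leaves over two of the twos of block \<open>n + 2\<close>.\<close>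
    show "replicate 1 L2 @- blocks (n + 2) = ?v @- replicate 2 L2 @- blocks (n + 3)"
      by (subst blocks_unfold)
        (simp add: numeral_2_eq_2 numeral_3_eq_3 replicate_shift_SCons)
  qed simp
  moreover have "binom_equiv 1 ?u ?v"
    by (simp add: binom_equiv_1_iff count_list_replicate del: One_nat_def)
  moreover have "\<not> binom_equiv 2 ?u ?v"
  proof
    assume "binom_equiv 2 ?u ?v"
    from binom_equivD[OF this, of "[L1, L2]"] show False
      by (simp add: sum_twos_after twos_after_replicate count_list_replicate)
  qed
  ultimately show ?thesis by (intro binom_complexity_less[of 1 2 ?u _ _ ?v]) simp_all
qed

text \<open>The offsets are \<open>2k+2, k+2, 1\<close> and \<open>2k+3, k+2, 0\<close>, both with
  sum \<open>3k+5\<close>. By \<open>2 <= k\<close> the block before \<open>blocks k\<close>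
  supplies the leading \<open>2\<close> of \<open>?u\<close>.\<close>

lemma binom_complexity_2_less_3:
  assumes "2 \<le> k"
  shows "binom_complexity 2 (L0 ## blocks 0) (2 * k + 6) < binom_complexity 3 (L0 ## blocks 0) (2 * k + 6)"
proof -
  let ?u = "L2 # L1 # replicate k L2 @ L1 # replicate (k + 1) L2 @ [L1, L2]"
  let ?v = "L1 # replicate (k + 1) L2 @ L1 # replicate (k + 2) L2 @ [L1]"
  have len: "length ?u = 2 * k + 6" "length ?v = 2 * k + 6" by simp_all
  have u: "?u \<in> factors (L0 ## blocks 0) (length ?u)"
  proof (rule factor_blocksI)
    show "replicate 1 L2 @- blocks k = ?u @- replicate (k + 1) L2 @- blocks (k + 3)"
      by (subst blocks_unfold, subst blocks_unfold, subst blocks_unfold)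
        (simp add: numeral_3_eq_3)
  qed (use assms in simp)
  have v: "?v \<in> factors (L0 ## blocks 0) (length ?v)"
  proof (rule factor_blocksI)
    show "replicate 0 L2 @- blocks (k + 1) = ?v @- replicate (k + 3) L2 @- blocks (k + 4)"
      by (subst blocks_unfold, subst blocks_unfold, subst blocks_unfold)
        (simp add: eval_nat_numeral)
  qed simp
  have "binom_equiv 2 ?u ?v"
  proof (rule binom_equiv_2I)
    show "count_list ?u a = count_list ?v a" for a
      by (simp add: count_list_replicate)
    show "binom_word ?u [L1, L2] = binom_word ?v [L1, L2]"
      by (simp add: sum_twos_after twos_after_append twos_after_replicate count_list_replicate)
  qed simp
  moreover have "\<not> binom_equiv 3 ?u ?v"
  proof
    \<comment> \<open>The words differ in their first letter, so rigidity replaces computing the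
      coefficients of \<open>122\<close>.\<close>
    assume "binom_equiv 3 ?u ?v"
    from factors_binom_equiv_3_eq[OF u[unfolded len] v[unfolded len] this] show False by simp
  qed
  ultimately show ?thesis
    using u[unfolded len] v[unfolded len]
    by (intro binom_complexity_less[of 2 3 ?u _ _ ?v]) simp_all
qed

section \<open>Unboundedness of the abelian complexity\<close>

lemma binom_complexity_1_unbounded: "\<exists>n. m \<le> binom_complexity 1 (L0 ## blocks 0) n"
proof -
  obtain w where w: "blocks 0 = w @- blocks m" "count_list w L1 = m"
    using blocks_0_split by blast
  define n where "n = length w"
  obtain w' where w': "blocks 0 = w' @- blocks n" using blocks_0_split by blast
  \<comment> \<open>The count of ones goes from \<open>m\<close> down to at most one; the sign turns
    this into the ascent required by the discrete intermediate value theorem.\<close>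
  define f where "f i = - int (count_list (stake n (sdrop i (blocks 0))) L1)" for i
  have step: "\<bar>f (i + 1) - f i\<bar> \<le> 1" for i
  proof -
    define s where "s = sdrop i (blocks 0)"
    have s: "sdrop (i + 1) (blocks 0) = stl s" by (simp add: s_def flip: sdrop_stl)
    \<comment> \<open>The same \<open>n + 1\<close> letters are split at their last and at their
      first letter.\<close>
    have "count_list (stake n s @ [s !! n]) L1 = count_list (shd s # stake n (stl s)) L1"
      by (metis stake.simps(2) stake_Suc)
    then show ?thesis
      unfolding f_def s s_def[symmetric] by (auto split: if_splits)
  qed
  have f0: "f 0 = - int m"
    by (simp add: f_def w n_def stake_length_shift)
  have last: "- 1 \<le> f (length w')"
  proof (cases n)
    case (Suc n')
    \<comment> \<open>Block \<open>n\<close> has length \<open>n + 1\<close>, so a window of length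
      \<open>n\<close> at its start contains just one \<open>1\<close>.\<close>
    have "stake n (blocks n) = L1 # replicate n' L2"
      using stake_length_shift[of "replicate n' L2" "L2 ## blocks (Suc n)"]
      by (subst blocks_unfold) (simp add: Suc replicate_shift_SCons)
    then show ?thesis
      unfolding f_def w' sdrop_length_shift by (simp add: count_list_replicate)
  qed (simp add: f_def)
  have "{1..m} \<subseteq> (\<lambda>u. count_list u L1) ` factors (L0 ## blocks 0) n"
  proof
    fix j assume j: "j \<in> {1..m}"
    then obtain i where "f i = - int j"
      using nat0_intermed_int_val[of "length w'" f "- int j"] step f0 last by auto
    \<comment> \<open>\<open>Suc i\<close> skips the initial \<open>L0\<close>.\<close>
    then have "j = count_list (stake n (sdrop (Suc i) (L0 ## blocks 0))) L1"
      by (simp add: f_def)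
    then show "j \<in> (\<lambda>u. count_list u L1) ` factors (L0 ## blocks 0) n"
      using stake_sdrop_in_factors by blast
  qed
  then have "card {1..m} \<le> card ((\<lambda>u. count_list u L1) ` factors (L0 ## blocks 0) n)"
    by (intro card_mono) (simp_all add: finite_factors)
  then show ?thesis
    using card_count_le_binom_complexity_1 le_trans by fastforce
qed

theorem theorem7p4:
  fixes h :: "letter stream"
  assumes "morph_stream phi h = h" and "shd h = L0"
  shows "\<not> bdd_above (range (binom_complexity 1 h))
    \<and> binom_complexity 1 h \<prec> binom_complexity 2 h
    \<and> binom_complexity 2 h \<prec> binom_complexity 3 h
    \<and> binom_complexity 3 h = factor_complexity h"
proof (intro conjI)
  note h = fixed_point_eq_blocks[OF assms]
  show "\<not> bdd_above (range (binom_complexity 1 h))"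
  proof
    assume "bdd_above (range (binom_complexity 1 h))"
    then obtain B where "\<And>n. binom_complexity 1 h n \<le> B" by (auto simp: bdd_above_def)
    then show False
      using binom_complexity_1_unbounded[of "Suc B"] h by (metis Suc_n_not_le_n le_trans)
  qed
  show "binom_complexity 1 h \<prec> binom_complexity 2 h"
    unfolding inf_often_less_def INFM_nat h
  proof
    fix m
    show "\<exists>n>m. binom_complexity 1 (L0 ## blocks 0) n < binom_complexity 2 (L0 ## blocks 0) n"
      using binom_complexity_1_less_2[of m] by (intro exI[of _ "m + 2"]) simp
  qed
  show "binom_complexity 2 h \<prec> binom_complexity 3 h"
    unfolding inf_often_less_def INFM_nat h
  proof
    fix m
    show "\<exists>n>m. binom_complexity 2 (L0 ## blocks 0) n < binom_complexity 3 (L0 ## blocks 0) n"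
      using binom_complexity_2_less_3[of "m + 2"] by (intro exI[of _ "2 * (m + 2) + 6"]) simp
  qed
  show "binom_complexity 3 h = factor_complexity h"
    unfolding h
    by (intro ext binom_complexity_eq_factor_complexity) (rule factors_binom_equiv_3_eq)
qed

end
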